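(* The optimization problem $$\max\ PCS=P\Big\{\bigcap_{i_h\in S_o}\bigcap_{j_g\in S_n}\hat f(x_{i_h})\le\hat f(x_{j_g})\Big\}\quad\text{s.t. }\sum_{h=1}^l\sum_{i_h=1_h}^{k_h}n_{i_h}=n$$ can be asymptotically optimized with the following allocation rule within the partitions $h=1,\dots,l$: $$\alpha_{r_h}^*=\begin{cases}\dfrac{|z_{r_h}|}{|z_{1_h}|+|z_{s_h}|+|z_{k_h}|},&r_h=1_h,s_h,k_h,\\[4pt]0,&\text{otherwise},\end{cases}\qquad\text{where}\quad z_{r_h}^2=\begin{cases}\rho_{mi_b^*,r}^2,&h=b,\\ \eta_{i_h^*,r}^2,&\text{otherwise},\end{cases}$$ for $r_h=1_h,s_h,k_h$. Here $i_h^*$ is the key design of partition $h$: $$i_h^*=\begin{cases}\arg\min\limits_{1_h\le i_h\le k_h}\Big\{\min\limits_{i_h\in S_o}R_{m_b,i_h}(\theta_b,\theta_h,\boldsymbol{\alpha_b},\boldsymbol{\alpha_h}),\ \min\limits_{i_h\in S_n}R_{m_b,i_h}(\theta_b,\theta_h,\boldsymbol{\alpha_b},\boldsymbol{\alpha_h})\Big\},&h\ne b,\\[8pt] \arg\min\limits_{1_b\le i_b\le k_b}\Big\{\min\limits_{i_b\in S_o,\,i_b\ne m_b}R_{m_b,i_b}(\theta_b,\boldsymbol{\alpha_b}),\ \min\limits_{i_b\in S_n}R_{m_b,i_b}(\theta_b,\boldsymbol{\alpha_b})\Big\},&h=b.\end{cases}$$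
   Context: The domain is divided into $l$ adjacent partitions. Partition $h$ contains $k^h$ designs $1_h,2_h,\dots,k_h$ at real locations $x_{1_h}<\dots<x_{k_h}$; in each partition the mean performance is quadratic, $f(x_{i_h})=\beta_{h0}+\beta_{h1}x_{i_h}+\beta_{h2}x_{i_h}^2$. $S_o$ is the set of the $m$ designs with smallest means among all designs, $S_n$ its complement, $\max_{S_o}f<\min_{S_n}f$. $m_b$ is the design with the $m$-th smallest mean, lying in partition $b$. Simulation noise in partition $h$ is independent $N(0,\sigma_h^2)$. $n_{i_h}$ is the number of replications of design $i_h$; a fraction $\theta_h$ of the total budget $n$ goes to partition $h$, and within partition $h$ it is split among three support designs $1_h,s_h,k_h$ ($x_{1_h}<x_{s_h}<x_{k_h}$) in proportions $\boldsymbol{\alpha_h}=(\alpha_{1_h},\alpha_{s_h},\alpha_{k_h})$. $\hat f$ is obtained in each partition by a separate quadratic least-squares regression. For a design $i_h$ of partition $h$: $$\eta_{i_h,1}=\tfrac{(x_{s_h}-x_{i_h})(x_{k_h}-x_{i_h})}{(x_{1_h}-x_{s_h})(x_{1_h}-x_{k_h})},\quad \eta_{i_h,s}=\tfrac{(x_{1_h}-x_{i_h})(x_{k_h}-x_{i_h})}{(x_{s_h}-x_{1_h})(x_{s_h}-x_{k_h})},\quad \eta_{i_h,k}=\tfrac{(x_{1_h}-x_{i_h})(x_{s_h}-x_{i_h})}{(x_{k_h}-x_{1_h})(x_{k_h}-x_{s_h})},$$ and for designs of partition $b$: $\rho_{mi_b,r}=\eta_{m_b,r}-\eta_{i_b,r}$,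 $r=1,s,k$ (so $\rho_{mi_b^*,r}$ is this quantity at $i_b=i_b^*$). The exponential decay rates in $n$ of the probability of incorrectly comparing a design with $m_b$ are $$R_{m_b,i_h}(\theta_b,\theta_h,\boldsymbol{\alpha_b},\boldsymbol{\alpha_h})=\frac{(f(x_{m_b})-f(x_{i_h}))^2/2}{\frac{\sigma_b^2}{\theta_b}\Big(\frac{\eta_{m_b,1}^2}{\alpha_{1_b}}+\frac{\eta_{m_b,s}^2}{\alpha_{s_b}}+\frac{\eta_{m_b,k}^2}{\alpha_{k_b}}\Big)+\frac{\sigma_h^2}{\theta_h}\Big(\frac{\eta_{i_h,1}^2}{\alpha_{1_h}}+\frac{\eta_{i_h,s}^2}{\alpha_{s_h}}+\frac{\eta_{i_h,k}^2}{\alpha_{k_h}}\Big)}\quad(h\ne b),$$ $$R_{m_b,i_b}(\theta_b,\boldsymbol{\alpha_b})=\frac{(f(x_{m_b})-f(x_{i_b}))^2/2}{\frac{\sigma_b^2}{\theta_b}\Big(\frac{\rho_{mi_b,1}^2}{\alpha_{1_b}}+\frac{\rho_{mi_b,s}^2}{\alpha_{s_b}}+\frac{\rho_{mi_b,k}^2}{\alpha_{k_b}}\Big)}\quad(i_b\ne m_b),$$ terms $0/0$ being read as $0$. Asymptotic sense: as $n\to\infty$, the decay rate of $PFS=1-PCS$ is the minimum of all these rates (over all designs other than $m_b$), and the asymptotic version of the problem is to maximize this minimum over $\theta_h,\boldsymbol{\alpha_h}\ge0$ with $\sum_h\theta_h=1$ and $\alpha_{1_h}+\alpha_{s_h}+\alpha_{k_h}=1$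 for all $h$. Moreover the number of partitions $l$ goes to infinity, in which case $\theta_h/\theta_b\to0$ for $h\ne b$ and in this max-min problem $R_{m_b,i_h}(\theta_b,\theta_h,\boldsymbol{\alpha_b},\boldsymbol{\alpha_h})$, $h\neq b$, is replaced by its limit $$\widetilde R_{m_b,i_h}(\theta_h,\boldsymbol{\alpha_h})=\frac{(f(x_{m_b})-f(x_{i_h}))^2/2}{\frac{\sigma_h^2}{\theta_h}\Big(\frac{\eta_{i_h,1}^2}{\alpha_{1_h}}+\frac{\eta_{i_h,s}^2}{\alpha_{s_h}}+\frac{\eta_{i_h,k}^2}{\alpha_{k_h}}\Big)}.$$ The rule gives the $\boldsymbol{\alpha_h}$-part of the asymptotically optimal solution.
   Formalization: False unconditionally (h≠b, k_h=3). Shown: if all θ_h>0 and α obeys the rule for its key designs, α is part of an optimum; at any optimum the rule holds in each partition with unique key design if no mean ties with m_b's. Key designs for h≠b use the limit rates R̃. *)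

theory Defs
  imports "HOL-Library.Extended_Nonnegative_Real"
begin

text \<open>
  A design is a pair (h, i): partition number h and number i inside the partition, both
  counted from 1. The support designs of partition h are numbered 1, s(h) and k(h).
\<close>

record selection_problem =
  npart :: nat                           (* l *)
  ndes :: "nat \<Rightarrow> nat"                   (* k(h) *)
  loc :: "nat \<Rightarrow> nat \<Rightarrow> real"             (* x *)
  beta0 :: "nat \<Rightarrow> real"
  beta1 :: "nat \<Rightarrow> real"
  beta2 :: "nat \<Rightarrow> real"
  sd :: "nat \<Rightarrow> real"                     (* sigma *)
  mid :: "nat \<Rightarrow> nat"                     (* s(h) *)
  nsel :: nat                            (* m *)
  sel :: "(nat \<times> nat) set"               (* S_o *)
  bpart :: nat                           (* b *)
  bidx :: nat                            (* the number of m_b inside partition b *)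

definition parts :: "selection_problem \<Rightarrow> nat set" where
  "parts P = {1..npart P}"

definition designs :: "selection_problem \<Rightarrow> (nat \<times> nat) set" where
  "designs P = Sigma (parts P) (\<lambda>h. {1..ndes P h})"

definition nonsel :: "selection_problem \<Rightarrow> (nat \<times> nat) set" where
  "nonsel P = designs P - sel P"

definition bdesign :: "selection_problem \<Rightarrow> nat \<times> nat" where
  "bdesign P = (bpart P, bidx P)"

fun perf :: "selection_problem \<Rightarrow> nat \<times> nat \<Rightarrow> real" where
  "perf P (h, i) = beta0 P h + beta1 P h * loc P h i + beta2 P h * (loc P h i)\<^sup>2"

text \<open>
  The design with the m-th smallest mean is a design of largest mean among the m selected ones;
  ties inside the selected set are not excluded.
\<close>

definition valid_problem :: "selection_problem \<Rightarrow> bool" where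
  "valid_problem P \<longleftrightarrow>
     (\<forall>h\<in>parts P. strict_mono_on {1..ndes P h} (loc P h)
        \<and> 1 < mid P h \<and> mid P h < ndes P h \<and> 0 < sd P h) \<and>
     sel P \<subseteq> designs P \<and> card (sel P) = nsel P \<and>
     (\<forall>d\<in>sel P. \<forall>e\<in>nonsel P. perf P d < perf P e) \<and>
     bdesign P \<in> sel P \<and> (\<forall>d\<in>sel P. perf P d \<le> perf P (bdesign P))"

definition support :: "selection_problem \<Rightarrow> nat \<Rightarrow> nat set" where
  "support P h = {1, mid P h, ndes P h}"

text \<open>Weight of the sample mean at support design r in the quadratic fit at design i.\<close>

definition eta :: "selection_problem \<Rightarrow> nat \<Rightarrow> nat \<Rightarrow> nat \<Rightarrow> real" where
  "eta P h i r =
    (let x = loc P h; s = mid P h; k = ndes P h in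
     if r = 1 then ((x s - x i) * (x k - x i)) / ((x 1 - x s) * (x 1 - x k))
     else if r = s then ((x 1 - x i) * (x k - x i)) / ((x s - x 1) * (x s - x k))
     else if r = k then ((x 1 - x i) * (x s - x i)) / ((x k - x 1) * (x k - x s))
     else 0)"

definition rho :: "selection_problem \<Rightarrow> nat \<Rightarrow> nat \<Rightarrow> real" where
  "rho P i r = eta P (bpart P) (bidx P) r - eta P (bpart P) i r"

text \<open>
  Rates are computed in the extended nonnegative reals, where a / 0 is infinite for positive a,
  0 / 0 = 0 and a / \<infinity> = 0 for finite a. So a support design that is needed but gets no
  replications makes the rate 0, and terms 0 / 0 vanish.
\<close>

definition spread :: "selection_problem \<Rightarrow> nat \<Rightarrow> (nat \<Rightarrow> real) \<Rightarrow> (nat \<Rightarrow> real) \<Rightarrow> ennreal" where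
  "spread P h w a = (\<Sum>r\<in>support P h. ennreal ((w r)\<^sup>2) / ennreal (a r))"

definition gap :: "selection_problem \<Rightarrow> nat \<times> nat \<Rightarrow> ennreal" where
  "gap P d = ennreal ((perf P (bdesign P) - perf P d)\<^sup>2 / 2)"

definition R_other ::
  "selection_problem \<Rightarrow> real \<Rightarrow> real \<Rightarrow> (nat \<Rightarrow> real) \<Rightarrow> (nat \<Rightarrow> real) \<Rightarrow> nat \<times> nat \<Rightarrow> ennreal" where
  "R_other P \<theta>b \<theta>h \<alpha>b \<alpha>h = (\<lambda>(h, i). gap P (h, i) /
     (ennreal ((sd P (bpart P))\<^sup>2) / ennreal \<theta>b * spread P (bpart P) (eta P (bpart P) (bidx P)) \<alpha>b
      + ennreal ((sd P h)\<^sup>2) / ennreal \<theta>h * spread P h (eta P h i) \<alpha>h))"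

definition R_lim :: "selection_problem \<Rightarrow> real \<Rightarrow> (nat \<Rightarrow> real) \<Rightarrow> nat \<times> nat \<Rightarrow> ennreal" where
  "R_lim P \<theta>h \<alpha>h = (\<lambda>(h, i). gap P (h, i) /
     (ennreal ((sd P h)\<^sup>2) / ennreal \<theta>h * spread P h (eta P h i) \<alpha>h))"

definition R_same :: "selection_problem \<Rightarrow> real \<Rightarrow> (nat \<Rightarrow> real) \<Rightarrow> nat \<Rightarrow> ennreal" where
  "R_same P \<theta>b \<alpha>b i = gap P (bpart P, i) /
     (ennreal ((sd P (bpart P))\<^sup>2) / ennreal \<theta>b * spread P (bpart P) (rho P i) \<alpha>b)"

text \<open>
  The next lemmas justify using \<open>R_lim\<close> in place of \<open>R_other\<close>: per unit of the share of
  partition h, the two rates become equal when that share is negligible against the one of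
  partition b. (Without this normalization both rates may tend to 0.)
\<close>

lemma ennreal_div_one: "a / 1 = (a :: ennreal)"
  by (metis divide_ennreal_def inverse_ennreal ennreal_1 inverse_1 mult.right_neutral zero_less_one)

lemma rate_per_share: fixes g A B s t:: ennreal and x y u v::real
  assumes "0<x" "0<y" "g<top" "A<top"
  shows "g / (ennreal u / ennreal x * A + ennreal v / ennreal y * B) / ennreal y
    = g / (ennreal u * A * ennreal (y/x) + ennreal v * B)"
proof -
  let ?Y = "ennreal y"
  have Y: "0 < ?Y" "?Y < top" using assms by auto
  have e: "a / b / ?Y = a / (b * ?Y)" for a b :: ennreal
    using Y by (cases "b = 0"; cases "b=top") (auto simp: divide_ennreal_def ennreal_inverse_mult' less_top mult.assoc ennreal_top_mult)
  have "ennreal v / ?Y * B * ?Y = ennreal v * B * (?Y / ?Y)"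
    by (simp add: divide_ennreal_def mult_ac)
  also have "?Y / ?Y = 1" using Y by (intro ennreal_divide_self) auto
  finally have b: "ennreal v / ?Y * B * ?Y = ennreal v * B" by simp
  have "ennreal u / ennreal x * A * ?Y = ennreal u * A * (?Y / ennreal x)"
    by (simp add: divide_ennreal_def mult_ac)
  also have "?Y / ennreal x = ennreal (y/x)" using assms by (simp add: divide_ennreal)
  finally have a: "ennreal u / ennreal x * A * ?Y = ennreal u * A * ennreal (y/x)" .
  show ?thesis unfolding e distrib_right a b ..
qed

lemma rate_per_share_tendsto: fixes g A B :: ennreal and q :: "'a \<Rightarrow> real"
  assumes "(q \<longlongrightarrow> 0) F" "g<top" "A<top"
  shows "((\<lambda>l. g / (A * ennreal (q l) + B)) \<longlongrightarrow> g / B) F"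
proof -
  have "((\<lambda>l. ennreal (q l)) \<longlongrightarrow> 0) F" using tendsto_ennrealI[OF assms(1)] by simp
  then have "((\<lambda>l. A * ennreal (q l)) \<longlongrightarrow> A * 0) F" by (rule ennreal_tendsto_cmult[OF assms(3)])
  then have "((\<lambda>l. A * ennreal (q l) + B) \<longlongrightarrow> A * 0 + B) F" by (intro tendsto_add) auto
  then have "((\<lambda>l. A * ennreal (q l) + B) \<longlongrightarrow> B) F" by simp
  then have "((\<lambda>l. inverse (A * ennreal (q l) + B)) \<longlongrightarrow> inverse B) F"
    by (rule continuous_on_tendsto_compose[OF continuous_on_inverse_ennreal[OF continuous_on_id], of _ _ _ UNIV, simplified])
  from ennreal_tendsto_cmult[OF assms(2) this] show ?thesis by (simp add: divide_ennreal_def)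
qed

lemma R_lim_per_share:
  assumes "0 < t"
  shows "R_lim P t \<alpha>h d / ennreal t = R_lim P 1 \<alpha>h d"
  using rate_per_share[of 1 t "gap P d" 0 0 "(sd P (fst d))\<^sup>2" "spread P (fst d) (eta P (fst d) (snd d)) \<alpha>h"] assms
  by (cases d) (simp add: R_lim_def gap_def ennreal_div_one)

lemma R_other_tendsto_R_lim:
  fixes \<theta>b \<theta>h :: "'a \<Rightarrow> real"
  assumes "((\<lambda>l. \<theta>h l / \<theta>b l) \<longlongrightarrow> 0) F"
    and "\<forall>\<^sub>F l in F. 0 < \<theta>b l" and "\<forall>\<^sub>F l in F. 0 < \<theta>h l"
    and "spread P (bpart P) (eta P (bpart P) (bidx P)) \<alpha>b < top"
  shows "((\<lambda>l. R_other P (\<theta>b l) (\<theta>h l) \<alpha>b \<alpha>h d / ennreal (\<theta>h l)) \<longlongrightarrow> R_lim P 1 \<alpha>h d) F"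
proof -
  obtain h i where d: "d = (h, i)" by (cases d)
  let ?A = "ennreal ((sd P (bpart P))\<^sup>2) * spread P (bpart P) (eta P (bpart P) (bidx P)) \<alpha>b"
  let ?B = "ennreal ((sd P h)\<^sup>2) * spread P h (eta P h i) \<alpha>h"
  have "?A < top" using assms(4) by (simp add: ennreal_mult_less_top)
  then have "((\<lambda>l. gap P d / (?A * ennreal (\<theta>h l / \<theta>b l) + ?B)) \<longlongrightarrow> gap P d / ?B) F"
    by (intro rate_per_share_tendsto assms(1)) (simp add: gap_def)
  moreover have "\<forall>\<^sub>F l in F. gap P d / (?A * ennreal (\<theta>h l / \<theta>b l) + ?B)
      = R_other P (\<theta>b l) (\<theta>h l) \<alpha>b \<alpha>h d / ennreal (\<theta>h l)"
    using assms(2,3)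
  proof eventually_elim
    case (elim l)
    show ?case unfolding d R_other_def prod.case
      by (rule rate_per_share[symmetric]) (use elim assms(4) in \<open>auto simp: gap_def\<close>)
  qed
  ultimately have "((\<lambda>l. R_other P (\<theta>b l) (\<theta>h l) \<alpha>b \<alpha>h d / ennreal (\<theta>h l)) \<longlongrightarrow> gap P d / ?B) F"
    by (rule Lim_transform_eventually)
  moreover have "gap P d / ?B = R_lim P 1 \<alpha>h d" by (simp add: R_lim_def d ennreal_div_one)
  ultimately show ?thesis by simp
qed

text \<open>
  \<open>\<theta> h\<close> is the share of partition h in the budget, \<open>\<alpha> h i\<close> the share of design i inside
  partition h. Values at indices that do not denote partitions or designs are irrelevant.
\<close>

definition feasible :: "selection_problem \<Rightarrow> (nat \<Rightarrow> real) \<Rightarrow> (nat \<Rightarrow> nat \<Rightarrow> real) \<Rightarrow> bool" where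
  "feasible P \<theta> \<alpha> \<longleftrightarrow>
     (\<forall>h\<in>parts P. 0 \<le> \<theta> h) \<and> (\<Sum>h\<in>parts P. \<theta> h) = 1 \<and>
     (\<forall>h\<in>parts P. (\<forall>i\<in>{1..ndes P h}. 0 \<le> \<alpha> h i) \<and>
        (\<forall>i\<in>{1..ndes P h} - support P h. \<alpha> h i = 0) \<and>
        (\<Sum>r\<in>support P h. \<alpha> h r) = 1)"

definition rate ::
  "selection_problem \<Rightarrow> (nat \<Rightarrow> real) \<Rightarrow> (nat \<Rightarrow> nat \<Rightarrow> real) \<Rightarrow> nat \<times> nat \<Rightarrow> ennreal" where
  "rate P \<theta> \<alpha> = (\<lambda>(h, i).
     if h = bpart P then R_same P (\<theta> h) (\<alpha> h) i else R_lim P (\<theta> h) (\<alpha> h) (h, i))"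

definition PFS_rate :: "selection_problem \<Rightarrow> (nat \<Rightarrow> real) \<Rightarrow> (nat \<Rightarrow> nat \<Rightarrow> real) \<Rightarrow> ennreal" where
  "PFS_rate P \<theta> \<alpha> = Min (rate P \<theta> \<alpha> ` (designs P - {bdesign P}))"

definition asymptotically_optimal ::
  "selection_problem \<Rightarrow> (nat \<Rightarrow> real) \<Rightarrow> (nat \<Rightarrow> nat \<Rightarrow> real) \<Rightarrow> bool" where
  "asymptotically_optimal P \<theta> \<alpha> \<longleftrightarrow>
     feasible P \<theta> \<alpha> \<and> (\<forall>\<theta>' \<alpha>'. feasible P \<theta>' \<alpha>' \<longrightarrow> PFS_rate P \<theta>' \<alpha>' \<le> PFS_rate P \<theta> \<alpha>)"

text \<open>
  The smaller of the minimum over selected and the minimum over nonselected designs is the minimum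
  over all designs of the partition other than \<open>bdesign P\<close>.
\<close>

definition key_design ::
  "selection_problem \<Rightarrow> (nat \<Rightarrow> real) \<Rightarrow> (nat \<Rightarrow> nat \<Rightarrow> real) \<Rightarrow> nat \<Rightarrow> nat \<Rightarrow> bool" where
  "key_design P \<theta> \<alpha> h i \<longleftrightarrow>
     is_arg_min (\<lambda>j. rate P \<theta> \<alpha> (h, j))
       (\<lambda>j. (h, j) \<in> sel P \<and> (h, j) \<noteq> bdesign P \<or> (h, j) \<in> nonsel P) i"

definition zcoef :: "selection_problem \<Rightarrow> nat \<Rightarrow> nat \<Rightarrow> nat \<Rightarrow> real" where
  "zcoef P h i r = (if h = bpart P then rho P i r else eta P h i r)"

definition alpha_rule :: "selection_problem \<Rightarrow> nat \<Rightarrow> nat \<Rightarrow> nat \<Rightarrow> real" where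
  "alpha_rule P h i r =
     (if r \<in> support P h then \<bar>zcoef P h i r\<bar> / (\<Sum>q\<in>support P h. \<bar>zcoef P h i q\<bar>) else 0)"

end

theory Submission
  imports Defs
begin

text \<open>
  The rate of a design \<open>(h, i)\<close> other than \<open>bdesign P\<close> is the share \<open>\<theta> h\<close> times a
  number that depends on \<open>\<alpha> h\<close> only, its \<open>unit_rate\<close>
  (\<open>rate_eq_share_times_unit_rate\<close>). So the max-min problem splits: inside each partition
  the least unit rate is to be made large, and the shares then balance the partitions.

  Inside a partition, the unit rate of design \<open>i\<close> is inversely proportional to
  \<open>\<Sum>r. z\<^sub>r\<^sup>2 / a\<^sub>r\<close>, where \<open>\<Sum>r. a\<^sub>r = 1\<close>. By the Cauchy-Schwarz inequality
  this sum is at least \<open>(\<Sum>r. \<bar>z\<^sub>r\<bar>)\<^sup>2\<close>, with equality exactly when \<open>a\<close> is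
  proportional to \<open>\<bar>z\<bar>\<close> (\<open>sum_square_div_excess\<close>); this is the allocation rule.

  Sufficiency (\<open>rule_extends_to_optimum\<close>): if the split follows the rule for a key design, no
  other split can give this key design a larger unit rate, hence none has a larger least unit rate.
  Let \<open>c h\<close> be the unit rate of the key design. If all \<open>c h\<close> are positive, shares
  proportional to \<open>1 / c h\<close> equalize the partitions and are optimal, because any other shares
  are no larger in some partition. If some \<open>c h\<close> is 0, every allocation has rate 0. Positive
  shares do not influence which design is the key design.

  Necessity (\<open>optimum_follows_rule\<close>): suppose that all gaps are positive and an optimal
  split deviates from the rule in partition \<open>h\<close>, whose key design is unique. Moving the split
  slightly towards the rule strictly increases the unit rate of the key design, by strictness in Cauchy-Schwarz and convexity of
  \<open>1 / a\<close>; the other unit rates lose at most a factor close to 1, so they stay above the old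
  minimum. Partition \<open>h\<close> then has slack, and giving part of its share to all partitions raises
  the overall minimum (\<open>gain_in_one_partition_improves\<close>), contradicting optimality.
\<close>

section \<open>Unit rates and feasible splits\<close>

definition proper_split :: "selection_problem \<Rightarrow> nat \<Rightarrow> (nat \<Rightarrow> real) \<Rightarrow> bool" where
  "proper_split P h a \<longleftrightarrow> (\<forall>i\<in>{1..ndes P h}. 0 \<le> a i) \<and>
     (\<forall>i\<in>{1..ndes P h} - support P h. a i = 0) \<and> (\<Sum>r\<in>support P h. a r) = 1"

definition rivals :: "selection_problem \<Rightarrow> (nat \<times> nat) set" where
  "rivals P = designs P - {bdesign P}"

definition abs_weight :: "selection_problem \<Rightarrow> nat \<Rightarrow> nat \<Rightarrow> real" where
  "abs_weight P h i = (\<Sum>r\<in>support P h. \<bar>zcoef P h i r\<bar>)"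

text \<open>
  Variance that partition \<open>h\<close> contributes to comparing design \<open>i\<close> with \<open>bdesign P\<close>, apart
  from the factor \<open>(sd P h)\<^sup>2 / \<theta> h\<close>. Real division returns 0 for \<open>z\<^sup>2 / 0\<close>, where the variance is
  infinite, so the value is meaningful only under \<open>covers\<close>.
\<close>

definition fit_variance :: "selection_problem \<Rightarrow> nat \<Rightarrow> (nat \<Rightarrow> real) \<Rightarrow> nat \<Rightarrow> real" where
  "fit_variance P h a i = (\<Sum>r\<in>support P h. (zcoef P h i r)\<^sup>2 / a r)"

text \<open>
  Every support design that the fit at \<open>i\<close> needs gets replications: the case of finite
  variance.
\<close>

definition covers :: "selection_problem \<Rightarrow> nat \<Rightarrow> (nat \<Rightarrow> real) \<Rightarrow> nat \<Rightarrow> bool" where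
  "covers P h a i \<longleftrightarrow> (\<forall>r\<in>support P h. a r = 0 \<longrightarrow> zcoef P h i r = 0)"

definition scaled_gap :: "selection_problem \<Rightarrow> nat \<Rightarrow> nat \<Rightarrow> real" where
  "scaled_gap P h i = (perf P (bdesign P) - perf P (h, i))\<^sup>2 / 2 / (sd P h)\<^sup>2"

text \<open>
  The value 0 without \<open>covers\<close> is the limit for infinite variance. It makes this real-valued
  function agree with the extended nonnegative rates for every feasible allocation.
\<close>

definition unit_rate :: "selection_problem \<Rightarrow> nat \<Rightarrow> (nat \<Rightarrow> real) \<Rightarrow> nat \<Rightarrow> real" where
  "unit_rate P h a i =
     (if covers P h a i then scaled_gap P h i / fit_variance P h a i else 0)"

section \<open>Cauchy-Schwarz and convexity\<close>

lemma finite_support [simp]: "finite (support P h)"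
  by (simp add: support_def)

text \<open>
  Cauchy-Schwarz with its defect: for nonnegative \<open>a\<close> the last sum is nonnegative, and it vanishes
  exactly when \<open>\<bar>w r\<bar> = W * a r\<close> for all \<open>r\<close>. Expanding the squares proves it, since
  \<open>\<Sum>r\<in>S. a r = 1\<close> makes the linear parts add up to constants. Terms with \<open>a r = 0\<close> are 0 on both sides.
\<close>

lemma sum_square_div_excess:
  fixes w a :: "'a \<Rightarrow> real"
  assumes "finite S" "(\<Sum>r\<in>S. a r) = 1" "\<forall>r\<in>S. a r = 0 \<longrightarrow> w r = 0"
  defines "W \<equiv> \<Sum>r\<in>S. \<bar>w r\<bar>"
  shows "(\<Sum>r\<in>S. (w r)\<^sup>2 / a r) = W\<^sup>2 + (\<Sum>r\<in>S. (\<bar>w r\<bar> - W * a r)\<^sup>2 / a r)"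
proof -
  have "(\<bar>w r\<bar> - W * a r)\<^sup>2 / a r = (w r)\<^sup>2 / a r - 2 * W * \<bar>w r\<bar> + W\<^sup>2 * a r" if "r \<in> S" for r
    using assms(3) that by (cases "a r = 0") (auto simp: power2_eq_square field_simps)
  then have "(\<Sum>r\<in>S. (\<bar>w r\<bar> - W * a r)\<^sup>2 / a r)
      = (\<Sum>r\<in>S. (w r)\<^sup>2 / a r) - 2 * W * W + W\<^sup>2 * (\<Sum>r\<in>S. a r)"
    by (simp add: sum.distrib sum_subtractf sum_distrib_left W_def)
  then show ?thesis by (simp add: assms(2) power2_eq_square)
qed

text \<open>
  Convexity of \<open>1 / x\<close>: it lets a small step towards the rule already pay off.
\<close>

lemma square_div_convex:
  fixes w a b t :: real
  assumes "0 < a" "0 < b" "0 \<le> t" "t \<le> 1"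
  shows "w\<^sup>2 / ((1 - t) * a + t * b) \<le> (1 - t) * (w\<^sup>2 / a) + t * (w\<^sup>2 / b)"
proof -
  have pos: "0 < (1 - t) * a + t * b"
    using assms by (cases "t = 0") (auto intro: add_nonneg_pos)
  have "((1 - t) / a + t / b) * ((1 - t) * a + t * b) = 1 + t * (1 - t) * (a - b)\<^sup>2 / (a * b)"
    using assms by (simp add: field_simps power2_eq_square)
  moreover have "0 \<le> t * (1 - t) * (a - b)\<^sup>2 / (a * b)" using assms by simp
  ultimately have "1 / ((1 - t) * a + t * b) \<le> (1 - t) / a + t / b"
    using pos by (simp add: pos_divide_le_eq)
  from mult_left_mono[OF this, of "w\<^sup>2"] show ?thesis by (simp add: algebra_simps)
qed

section \<open>Nondegeneracy of the weights\<close>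

text \<open>
  Quadratic Lagrange interpolation reproduces the polynomials \<open>1\<close> and \<open>x\<close>.
\<close>

lemma lagrange_basis_three_nodes:
  fixes a b c x :: real
  assumes "a \<noteq> b" "a \<noteq> c" "b \<noteq> c"
  shows "(b - x) * (c - x) / ((a - b) * (a - c)) + (a - x) * (c - x) / ((b - a) * (b - c))
      + (a - x) * (b - x) / ((c - a) * (c - b)) = 1"
    and "(b - x) * (c - x) / ((a - b) * (a - c)) * a + (a - x) * (c - x) / ((b - a) * (b - c)) * b
      + (a - x) * (b - x) / ((c - a) * (c - b)) * c = x"
proof -
  \<comment> \<open>In terms of the node distances, all denominators are products of three nonzero atoms.\<close>
  define p q where "p = a - b" and "q = b - c"
  have ne: "p \<noteq> 0" "q \<noteq> 0" "p + q \<noteq> 0" using assms by (auto simp: p_def q_def)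
  have e: "b = c + q" "a = c + q + p" by (auto simp: p_def q_def)
  have d: "c - (c + q + p) = - (p + q)" "c + q + p - c = p + q" by auto
  show "(b - x) * (c - x) / ((a - b) * (a - c)) + (a - x) * (c - x) / ((b - a) * (b - c))
      + (a - x) * (b - x) / ((c - a) * (c - b)) = 1"
    unfolding e using ne unfolding d by (simp add: divide_simps) (simp add: algebra_simps)
  show "(b - x) * (c - x) / ((a - b) * (a - c)) * a + (a - x) * (c - x) / ((b - a) * (b - c)) * b
      + (a - x) * (b - x) / ((c - a) * (c - b)) * c = x"
    unfolding e using ne unfolding d by (simp add: divide_simps) (simp add: algebra_simps)
qed

lemma eta_interpolates:
  assumes "inj_on (loc P h) {1..ndes P h}" "1 < mid P h" "mid P h < ndes P h"
  shows "(\<Sum>r\<in>support P h. eta P h i r) = 1"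
    and "(\<Sum>r\<in>support P h. eta P h i r * loc P h r) = loc P h i"
proof -
  have ne: "loc P h 1 \<noteq> loc P h (mid P h)" "loc P h 1 \<noteq> loc P h (ndes P h)"
      "loc P h (mid P h) \<noteq> loc P h (ndes P h)"
    using assms inj_on_eq_iff[OF assms(1)] by auto
  have sum: "(\<Sum>r\<in>support P h. f r) = f 1 + f (mid P h) + f (ndes P h)" for f :: "nat \<Rightarrow> real"
    using assms by (simp add: support_def)
  note lagrange = lagrange_basis_three_nodes[OF ne, of "loc P h i"]
  show "(\<Sum>r\<in>support P h. eta P h i r) = 1"
    using lagrange(1) assms(2,3) unfolding sum by (simp add: eta_def Let_def)
  show "(\<Sum>r\<in>support P h. eta P h i r * loc P h r) = loc P h i"
    using lagrange(2) assms(2,3) unfolding sum by (simp add: eta_def Let_def)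
qed

text \<open>
  The weights cannot all vanish, so that the rule is well defined and the variances are positive.
  The \<open>eta\<close> weights sum to 1. If all \<open>rho\<close> weights were 0, then reproducing \<open>x\<close> would
  force \<open>i\<close> and \<open>bdesign P\<close> to the same location.
\<close>

lemma abs_weight_pos:
  assumes P: "valid_problem P" and d: "(h, i) \<in> rivals P"
  shows "0 < abs_weight P h i"
proof (rule ccontr)
  assume "\<not> 0 < abs_weight P h i"
  then have "abs_weight P h i = 0"
    by (metis abs_weight_def sum_abs_ge_zero less_eq_real_def)
  then have z: "\<forall>r\<in>support P h. zcoef P h i r = 0"
    by (simp add: abs_weight_def sum_nonneg_eq_0_iff)
  have h: "h \<in> parts P" and i: "i \<in> {1..ndes P h}" and ib: "(h, i) \<noteq> bdesign P"
    using d by (auto simp: rivals_def designs_def)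
  have inj: "inj_on (loc P h) {1..ndes P h}" and m: "1 < mid P h" "mid P h < ndes P h"
    using P h by (auto simp: valid_problem_def intro: strict_mono_on_imp_inj_on)
  note lag = eta_interpolates[OF inj m]
  show False
  proof (cases "h = bpart P")
    case True
    then have "\<forall>r\<in>support P h. eta P h (bidx P) r = eta P h i r"
      using z by (simp add: zcoef_def rho_def)
    then have "loc P h (bidx P) = loc P h i"
      using lag(2)[of "bidx P"] lag(2)[of i] by simp
    moreover have "bidx P \<in> {1..ndes P h}"
      using P True by (auto simp: valid_problem_def bdesign_def designs_def)
    ultimately have "bidx P = i" using inj_onD[OF inj] i by blast
    then show False using ib True by (simp add: bdesign_def)
  next
    case False
    then show False using z lag(1)[of i] by (simp add: zcoef_def)
  qed
qed

section \<open>The rule minimizes the variance\<close>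

lemma split_support:
  assumes "valid_problem P" "h \<in> parts P" "proper_split P h a"
  shows "\<forall>r\<in>support P h. 0 \<le> a r" "(\<Sum>r\<in>support P h. a r) = 1"
  using assms by (auto simp: valid_problem_def proper_split_def support_def)

lemma fit_variance_ge:
  assumes "\<forall>r\<in>support P h. 0 \<le> a r" "(\<Sum>r\<in>support P h. a r) = 1" "covers P h a i"
  shows "(abs_weight P h i)\<^sup>2 \<le> fit_variance P h a i"
proof -
  have "0 \<le> (\<Sum>r\<in>support P h. (\<bar>zcoef P h i r\<bar> - abs_weight P h i * a r)\<^sup>2 / a r)"
    using assms(1) by (intro sum_nonneg) auto
  then show ?thesis
    using sum_square_div_excess[of "support P h" a "zcoef P h i"] assms
    by (simp add: covers_def fit_variance_def abs_weight_def)
qed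

lemma fit_variance_gt:
  assumes "\<forall>r\<in>support P h. 0 \<le> a r" "(\<Sum>r\<in>support P h. a r) = 1" "covers P h a i"
    and "0 < abs_weight P h i" "r \<in> support P h" "a r \<noteq> alpha_rule P h i r"
  shows "(abs_weight P h i)\<^sup>2 < fit_variance P h a i"
proof -
  let ?W = "abs_weight P h i"
  have "a r \<noteq> 0"
    using assms by (auto simp: covers_def alpha_rule_def)
  moreover have "\<bar>zcoef P h i r\<bar> - ?W * a r \<noteq> 0"
    using assms(4-6) by (auto simp: alpha_rule_def abs_weight_def)
  ultimately have "0 < (\<bar>zcoef P h i r\<bar> - ?W * a r)\<^sup>2 / a r"
    using assms(1,5) by (simp add: less_le)
  then have "0 < (\<Sum>r\<in>support P h. (\<bar>zcoef P h i r\<bar> - ?W * a r)\<^sup>2 / a r)"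
    using assms(1,5) by (intro sum_pos2[where i = r]) auto
  then show ?thesis
    using sum_square_div_excess[of "support P h" a "zcoef P h i"] assms
    by (simp add: covers_def fit_variance_def abs_weight_def)
qed

lemma fit_variance_rule:
  assumes "0 < abs_weight P h i" "\<forall>r\<in>support P h. a r = alpha_rule P h i r"
  shows "covers P h a i" "fit_variance P h a i = (abs_weight P h i)\<^sup>2"
proof -
  let ?W = "abs_weight P h i"
  have a: "a r = \<bar>zcoef P h i r\<bar> / ?W" if "r \<in> support P h" for r
    using assms(2) that by (simp add: alpha_rule_def abs_weight_def)
  show "covers P h a i" using a assms(1) by (auto simp: covers_def)
  have "(zcoef P h i r)\<^sup>2 / a r = ?W * \<bar>zcoef P h i r\<bar>" if "r \<in> support P h" for r
    using a[OF that] assms(1) by (auto simp: power2_eq_square abs_if)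
  then have "fit_variance P h a i = ?W * ?W"
    by (simp add: fit_variance_def abs_weight_def sum_distrib_left)
  then show "fit_variance P h a i = ?W\<^sup>2" by (simp add: power2_eq_square)
qed

section \<open>The rate is linear in the share\<close>

lemma spread_eq_fit_variance:
  assumes "\<forall>r\<in>support P h. 0 \<le> a r" "covers P h a i"
  shows "spread P h (zcoef P h i) a = ennreal (fit_variance P h a i)"
proof -
  have "ennreal ((zcoef P h i r)\<^sup>2) / ennreal (a r) = ennreal ((zcoef P h i r)\<^sup>2 / a r)"
    if "r \<in> support P h" for r
    using assms that by (cases "a r = 0") (auto simp: covers_def divide_ennreal less_le)
  then show ?thesis using assms by (simp add: spread_def fit_variance_def sum_ennreal)
qed

lemma spread_eq_top:
  assumes "\<not> covers P h a i"
  shows "spread P h (zcoef P h i) a = top"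
proof -
  obtain r where "r \<in> support P h" "a r = 0" "zcoef P h i r \<noteq> 0"
    using assms by (auto simp: covers_def)
  then have "top = ennreal ((zcoef P h i r)\<^sup>2) / ennreal (a r)"
    by (simp add: ennreal_divide_eq_top_iff)
  also have "\<dots> \<le> spread P h (zcoef P h i) a"
    unfolding spread_def using \<open>r \<in> support P h\<close> by (intro member_le_sum) auto
  finally show ?thesis by (simp add: top_unique)
qed

text \<open>
  The step from extended nonnegative to real arithmetic. The variance is positive, so
  \<open>\<theta> h = 0\<close> gives an infinite denominator and rate 0, as does a missing support design.
\<close>

lemma rate_eq_share_times_unit_rate:
  assumes P: "valid_problem P" and d: "(h, i) \<in> rivals P"
    and \<theta>: "0 \<le> \<theta> h" and a: "proper_split P h (\<alpha> h)"
  shows "rate P \<theta> \<alpha> (h, i) = ennreal (\<theta> h * unit_rate P h (\<alpha> h) i)"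
proof -
  have h: "h \<in> parts P" using d by (auto simp: rivals_def designs_def)
  then have sd: "0 < sd P h" using P by (simp add: valid_problem_def)
  note sp = split_support[OF P h a]
  let ?S = "spread P h (zcoef P h i) (\<alpha> h)"
  let ?V = "fit_variance P h (\<alpha> h) i"
  have "zcoef P h i = (if h = bpart P then rho P i else eta P h i)"
    by (auto simp: zcoef_def)
  then have r: "rate P \<theta> \<alpha> (h, i) = gap P (h, i) / (ennreal ((sd P h)\<^sup>2) / ennreal (\<theta> h) * ?S)"
    by (simp add: rate_def R_same_def R_lim_def)
  show ?thesis
  proof (cases "covers P h (\<alpha> h) i")
    case False
    have "ennreal ((sd P h)\<^sup>2) / ennreal (\<theta> h) \<noteq> 0"
      using sd by (simp add: ennreal_divide_eq_0_iff)
    then show ?thesis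
      using False by (simp add: r spread_eq_top unit_rate_def ennreal_mult_top gap_def)
  next
    case True
    have V: "0 < ?V"
      using fit_variance_ge[OF sp True] abs_weight_pos[OF P d] by (meson less_le_trans zero_less_power)
    have S: "?S = ennreal ?V" by (rule spread_eq_fit_variance[OF sp(1) True])
    show ?thesis
    proof (cases "\<theta> h = 0")
      case True
      then show ?thesis using V sd by (simp add: r S ennreal_top_mult gap_def)
    next
      case False
      then have "0 < \<theta> h" using \<theta> by simp
      then show ?thesis using V sd True
        by (simp add: r S gap_def divide_ennreal unit_rate_def scaled_gap_def ennreal_mult[symmetric] mult.commute)
    qed
  qed
qed

section \<open>Bounds on unit rates\<close>

lemma scaled_gap_nonneg: "0 \<le> scaled_gap P h i"
  by (simp add: scaled_gap_def)

lemma unit_rate_nonneg: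
  assumes "\<forall>r\<in>support P h. 0 \<le> a r"
  shows "0 \<le> unit_rate P h a i"
  using assms by (auto simp: unit_rate_def fit_variance_def scaled_gap_nonneg
      intro!: divide_nonneg_nonneg sum_nonneg)

lemma fit_variance_pos:
  assumes "valid_problem P" "(h, i) \<in> rivals P" "proper_split P h a" "covers P h a i"
  shows "0 < fit_variance P h a i"
proof -
  have h: "h \<in> parts P" using assms(2) by (auto simp: rivals_def designs_def)
  have "0 < (abs_weight P h i)\<^sup>2" using abs_weight_pos[OF assms(1,2)] by simp
  also have "\<dots> \<le> fit_variance P h a i"
    by (rule fit_variance_ge[OF split_support[OF assms(1) h assms(3)] assms(4)])
  finally show ?thesis .
qed

text \<open>
  Optimality of the rule for one fixed design; applied to the key design it bounds the least unit
  rate of every split.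
\<close>

lemma unit_rate_le_rule:
  assumes "valid_problem P" "(h, i) \<in> rivals P" "proper_split P h a"
    and "\<forall>r\<in>support P h. a' r = alpha_rule P h i r"
  shows "unit_rate P h a i \<le> unit_rate P h a' i"
proof -
  have h: "h \<in> parts P" using assms(2) by (auto simp: rivals_def designs_def)
  note W = abs_weight_pos[OF assms(1,2)]
  note sp = split_support[OF assms(1) h assms(3)]
  have "scaled_gap P h i / fit_variance P h a i \<le> scaled_gap P h i / (abs_weight P h i)\<^sup>2"
    if "covers P h a i"
  proof -
    have "0 < (abs_weight P h i)\<^sup>2" using W by simp
    with fit_variance_pos[OF assms(1-3) that] have "0 < fit_variance P h a i * (abs_weight P h i)\<^sup>2"
      by (rule mult_pos_pos)
    with fit_variance_ge[OF sp that] scaled_gap_nonneg show ?thesis by (rule divide_left_mono)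
  qed
  then show ?thesis
    using fit_variance_rule[OF W assms(4)] by (auto simp: unit_rate_def scaled_gap_nonneg)
qed

lemma unit_rate_pos:
  assumes "valid_problem P" "(h, i) \<in> rivals P" "proper_split P h a"
    and "\<forall>r\<in>support P h. 0 < a r" and "0 < scaled_gap P h i"
  shows "0 < unit_rate P h a i"
proof -
  have "covers P h a i" using assms(4) by (auto simp: covers_def)
  then show ?thesis using fit_variance_pos[OF assms(1-3)] assms(5) by (simp add: unit_rate_def)
qed

section \<open>Moving a split towards the rule\<close>

lemma proper_split_mix:
  assumes "proper_split P h a" "proper_split P h b" "0 \<le> t" "t \<le> 1"
  shows "proper_split P h (\<lambda>r. (1 - t) * a r + t * b r)"
  using assms by (simp add: proper_split_def sum.distrib sum_distrib_left[symmetric])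

lemma proper_split_rule:
  assumes "0 < abs_weight P h i"
  shows "proper_split P h (alpha_rule P h i)"
proof -
  have "(\<Sum>r\<in>support P h. alpha_rule P h i r)
      = (\<Sum>r\<in>support P h. \<bar>zcoef P h i r\<bar> / abs_weight P h i)"
    by (intro sum.cong) (auto simp: alpha_rule_def abs_weight_def)
  also have "\<dots> = 1"
    using assms by (simp add: sum_divide_distrib[symmetric] abs_weight_def)
  finally show ?thesis by (auto simp: proper_split_def alpha_rule_def intro!: sum_nonneg divide_nonneg_nonneg)
qed

text \<open>
  After mixing, each support design keeps at least the fraction \<open>1 - t\<close> of its replications,
  so the variance grows by at most the factor \<open>1 / (1 - t)\<close>. This controls the designs for which
  the mixture is not favourable.
\<close>

lemma unit_rate_mix_ge:
  assumes P: "valid_problem P" and d: "(h, i) \<in> rivals P"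
    and a: "proper_split P h a" and b: "proper_split P h b" and t: "0 \<le> t" "t < 1"
  shows "(1 - t) * unit_rate P h a i \<le> unit_rate P h (\<lambda>r. (1 - t) * a r + t * b r) i"
proof -
  let ?m = "\<lambda>r. (1 - t) * a r + t * b r"
  have h: "h \<in> parts P" using d by (auto simp: rivals_def designs_def)
  have m: "proper_split P h ?m" using proper_split_mix[OF a b] t by simp
  note a0 = split_support(1)[OF P h a] and b0 = split_support(1)[OF P h b]
  show ?thesis
  proof (cases "covers P h a i")
    case False
    then show ?thesis
      using unit_rate_nonneg[OF split_support(1)[OF P h m]] by (simp add: unit_rate_def)
  next
    case ca: True
    have cm: "covers P h ?m i" unfolding covers_def
    proof (intro ballI impI)
      fix r assume r: "r \<in> support P h" and "?m r = 0"
      moreover have "0 \<le> (1 - t) * a r" "0 \<le> t * b r" using a0 b0 r t by auto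
      ultimately have "(1 - t) * a r = 0" by linarith
      then show "zcoef P h i r = 0" using ca r t by (simp add: covers_def)
    qed
    have "(zcoef P h i r)\<^sup>2 / ?m r \<le> (zcoef P h i r)\<^sup>2 / a r / (1 - t)" if r: "r \<in> support P h" for r
    proof (cases "a r = 0")
      case True
      then show ?thesis using ca r by (simp add: covers_def)
    next
      case False
      then have "0 < (1 - t) * a r" using a0 r t by (simp add: less_le)
      moreover have le: "(1 - t) * a r \<le> ?m r" using b0 r t by simp
      ultimately have "0 < ?m r * ((1 - t) * a r)" by (meson less_le_trans mult_pos_pos)
      then have "(zcoef P h i r)\<^sup>2 / ?m r \<le> (zcoef P h i r)\<^sup>2 / ((1 - t) * a r)"
        by (rule divide_left_mono[OF le zero_le_power2])
      then show ?thesis by (simp add: mult.commute)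
    qed
    then have "fit_variance P h ?m i \<le> fit_variance P h a i / (1 - t)"
      unfolding fit_variance_def sum_divide_distrib by (rule sum_mono)
    then have "scaled_gap P h i / (fit_variance P h a i / (1 - t)) \<le> scaled_gap P h i / fit_variance P h ?m i"
      using fit_variance_pos[OF P d a ca] fit_variance_pos[OF P d m cm] t scaled_gap_nonneg
      by (intro divide_left_mono mult_pos_pos divide_pos_pos) auto
    then show ?thesis using ca cm by (simp add: unit_rate_def mult.commute)
  qed
qed

text \<open>
  By convexity the variance of the mixture is at most the weighted mean of the old variance and the
  strictly smaller optimal one.
\<close>

lemma unit_rate_mix_rule_gt:
  assumes P: "valid_problem P" and d: "(h, i) \<in> rivals P"
    and a: "proper_split P h a" and t: "0 < t" "t < 1"
    and r: "r \<in> support P h" "a r \<noteq> alpha_rule P h i r"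
    and u: "0 < unit_rate P h a i"
  shows "unit_rate P h a i < unit_rate P h (\<lambda>r. (1 - t) * a r + t * alpha_rule P h i r) i"
proof -
  let ?b = "alpha_rule P h i"
  let ?m = "\<lambda>r. (1 - t) * a r + t * ?b r"
  let ?V = "\<lambda>a. fit_variance P h a i"
  have h: "h \<in> parts P" using d by (auto simp: rivals_def designs_def)
  note W = abs_weight_pos[OF P d]
  note b = proper_split_rule[OF W]
  have m: "proper_split P h ?m" using proper_split_mix[OF a b] t by simp
  note a0 = split_support(1)[OF P h a] and b0 = split_support(1)[OF P h b]
  have ca: "covers P h a i" using u by (auto simp: unit_rate_def split: if_splits)
  have cb: "covers P h ?b i" using fit_variance_rule(1)[OF W] by simp
  have pos: "0 < a q" "0 < ?b q" if "q \<in> support P h" "zcoef P h i q \<noteq> 0" for q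
    using that ca cb a0 b0 by (auto simp: covers_def less_le)
  have cm: "covers P h ?m i" unfolding covers_def
  proof (intro ballI impI)
    fix q assume "q \<in> support P h" and "?m q = 0"
    moreover have "0 < ?m q" if "q \<in> support P h" "zcoef P h i q \<noteq> 0"
      using pos[OF that] t by (intro add_pos_pos mult_pos_pos) auto
    ultimately show "zcoef P h i q = 0" by force
  qed
  have "(zcoef P h i q)\<^sup>2 / ?m q
      \<le> (1 - t) * ((zcoef P h i q)\<^sup>2 / a q) + t * ((zcoef P h i q)\<^sup>2 / ?b q)" if "q \<in> support P h" for q
  proof (cases "zcoef P h i q = 0")
    case False
    then show ?thesis using pos[OF that] t by (intro square_div_convex) auto
  qed simp
  then have "?V ?m \<le> (1 - t) * ?V a + t * ?V ?b"
    unfolding fit_variance_def sum_distrib_left sum.distrib[symmetric] by (rule sum_mono)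
  moreover have "?V ?b < ?V a"
    using fit_variance_gt[OF split_support[OF P h a] ca W r] fit_variance_rule(2)[OF W] by simp
  then have "t * ?V ?b < t * ?V a" using t by simp
  ultimately have "?V ?m < ?V a" by (simp add: algebra_simps)
  moreover have "0 < ?V ?m" by (rule fit_variance_pos[OF P d m cm])
  moreover have "0 < scaled_gap P h i"
    using u scaled_gap_nonneg[of P h i] ca by (auto simp: unit_rate_def less_le)
  ultimately have "scaled_gap P h i / ?V a < scaled_gap P h i / ?V ?m"
    by (intro divide_strict_left_mono mult_pos_pos) auto
  then show ?thesis using ca cm by (simp add: unit_rate_def)
qed

section \<open>The overall rate\<close>

lemma feasible_iff:
  "feasible P \<theta> \<alpha> \<longleftrightarrow> (\<forall>h\<in>parts P. 0 \<le> \<theta> h) \<and> (\<Sum>h\<in>parts P. \<theta> h) = 1 \<and>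
     (\<forall>h\<in>parts P. proper_split P h (\<alpha> h))"
  by (simp add: feasible_def proper_split_def)

lemma feasible_rate:
  assumes "valid_problem P" "feasible P \<theta> \<alpha>" "(h, i) \<in> rivals P"
  shows "rate P \<theta> \<alpha> (h, i) = ennreal (\<theta> h * unit_rate P h (\<alpha> h) i)"
proof -
  have "h \<in> parts P" using assms(3) by (auto simp: rivals_def designs_def)
  then show ?thesis using assms by (intro rate_eq_share_times_unit_rate) (auto simp: feasible_iff)
qed

lemma finite_rivals: "finite (rivals P)"
  by (simp add: rivals_def designs_def parts_def)

lemma rivals_nonempty:
  assumes "valid_problem P"
  shows "rivals P \<noteq> {}"
proof -
  have "bdesign P \<in> designs P" using assms by (auto simp: valid_problem_def)
  then have h: "bpart P \<in> parts P" by (simp add: bdesign_def designs_def)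
  then have "1 < mid P (bpart P)" "mid P (bpart P) < ndes P (bpart P)"
    using assms by (auto simp: valid_problem_def)
  then have "(bpart P, 1) \<in> designs P" "(bpart P, 2) \<in> designs P"
    using h by (auto simp: designs_def)
  moreover have "(bpart P, 1) \<noteq> bdesign P \<or> (bpart P, 2) \<noteq> bdesign P"
    by (auto simp: bdesign_def)
  ultimately show ?thesis unfolding rivals_def by blast
qed

lemma PFS_rate_le:
  assumes "valid_problem P" "feasible P \<theta> \<alpha>" "(h, i) \<in> rivals P"
  shows "PFS_rate P \<theta> \<alpha> \<le> ennreal (\<theta> h * unit_rate P h (\<alpha> h) i)"
  unfolding feasible_rate[OF assms, symmetric] PFS_rate_def rivals_def[symmetric]
  using assms finite_rivals by (intro Min_le) auto

lemma PFS_rate_ge: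
  assumes "valid_problem P" "feasible P \<theta> \<alpha>"
    and "\<And>h i. (h, i) \<in> rivals P \<Longrightarrow> v \<le> \<theta> h * unit_rate P h (\<alpha> h) i"
  shows "ennreal v \<le> PFS_rate P \<theta> \<alpha>"
proof -
  have "ennreal v \<le> rate P \<theta> \<alpha> d" if "d \<in> rivals P" for d
    using that assms(3) by (cases d) (simp add: feasible_rate[OF assms(1,2)] ennreal_leI)
  then show ?thesis
    unfolding PFS_rate_def rivals_def[symmetric]
    using finite_rivals rivals_nonempty[OF assms(1)] by (intro Min.boundedI) auto
qed

lemma PFS_rate_attained:
  assumes "valid_problem P" "feasible P \<theta> \<alpha>"
  obtains h i where "(h, i) \<in> rivals P" "PFS_rate P \<theta> \<alpha> = ennreal (\<theta> h * unit_rate P h (\<alpha> h) i)"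
proof -
  have "PFS_rate P \<theta> \<alpha> \<in> rate P \<theta> \<alpha> ` rivals P"
    unfolding PFS_rate_def rivals_def[symmetric]
    using finite_rivals rivals_nonempty[OF assms(1)] by (intro Min_in) auto
  then obtain d where "d \<in> rivals P" "PFS_rate P \<theta> \<alpha> = rate P \<theta> \<alpha> d" by auto
  then show ?thesis using that feasible_rate[OF assms] by (cases d) simp
qed

text \<open>
  Being a key design is a property of the split alone as long as the share is positive; hence
  shares can be rebalanced without changing the key designs.
\<close>

lemma key_design_iff:
  assumes P: "valid_problem P" and a: "proper_split P h (\<alpha> h)" and \<theta>: "0 < \<theta> h"
  shows "key_design P \<theta> \<alpha> h i \<longleftrightarrow> (h, i) \<in> rivals P \<and>
    (\<forall>j. (h, j) \<in> rivals P \<longrightarrow> unit_rate P h (\<alpha> h) i \<le> unit_rate P h (\<alpha> h) j)"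
proof -
  have rival: "((h, j) \<in> sel P \<and> (h, j) \<noteq> bdesign P \<or> (h, j) \<in> nonsel P) \<longleftrightarrow> (h, j) \<in> rivals P" for j
    using P by (auto simp: valid_problem_def nonsel_def rivals_def)
  have "rate P \<theta> \<alpha> (h, j) < rate P \<theta> \<alpha> (h, i) \<longleftrightarrow> unit_rate P h (\<alpha> h) j < unit_rate P h (\<alpha> h) i"
    if "(h, i) \<in> rivals P" "(h, j) \<in> rivals P" for j
  proof -
    have h: "h \<in> parts P" using that by (auto simp: rivals_def designs_def)
    show ?thesis
      using that \<theta> unit_rate_nonneg[OF split_support(1)[OF P h a]]
      by (simp add: rate_eq_share_times_unit_rate[OF P, where h = h and \<theta> = \<theta> and \<alpha> = \<alpha>] a ennreal_less_iff)
  qed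
  then show ?thesis unfolding key_design_def is_arg_min_def rival
    by (meson not_less)
qed

section \<open>Rebalancing the shares\<close>

text \<open>
  Slack in a single partition can be spread over all of them. If \<open>m > v\<close> is the least rate in
  partition \<open>h\<close>, its share can shrink by the factor \<open>v / m\<close> before its rates reach \<open>v\<close>.
  Now the shares sum to less than 1, and rescaling them to sum 1 lifts all rates strictly above
  \<open>v\<close>.
\<close>

lemma gain_in_one_partition_improves:
  assumes P: "valid_problem P" and f: "feasible P \<theta> \<alpha>" and h: "h \<in> parts P"
    and a: "proper_split P h a" and v: "0 < v"
    and others: "\<And>g j. (g, j) \<in> rivals P \<Longrightarrow> g \<noteq> h \<Longrightarrow> v \<le> \<theta> g * unit_rate P g (\<alpha> g) j"
    and gain: "\<And>j. (h, j) \<in> rivals P \<Longrightarrow> v < \<theta> h * unit_rate P h a j"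
    and i: "(h, i) \<in> rivals P"
  shows "\<exists>\<theta>'. feasible P \<theta>' (\<alpha>(h := a)) \<and> ennreal v < PFS_rate P \<theta>' (\<alpha>(h := a))"
proof -
  define J where "J = {j. (h, j) \<in> rivals P}"
  have "J \<subseteq> snd ` rivals P" by (force simp: J_def)
  then have J: "finite J" "J \<noteq> {}" using finite_rivals i by (auto simp: J_def intro: finite_subset)
  define m where "m = Min ((\<lambda>j. \<theta> h * unit_rate P h a j) ` J)"
  have m: "v < m" using J gain by (simp add: m_def J_def)
  have mle: "m \<le> \<theta> h * unit_rate P h a j" if "(h, j) \<in> rivals P" for j
    using J that unfolding m_def by (intro Min_le) (auto simp: J_def)
  have \<theta>: "\<forall>g\<in>parts P. 0 \<le> \<theta> g" "(\<Sum>g\<in>parts P. \<theta> g) = 1"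
    using f by (auto simp: feasible_iff)
  have fin: "finite (parts P)" by (simp add: parts_def)
  have \<theta>1: "\<theta> h \<le> 1" using member_le_sum[OF h, of \<theta>] \<theta> fin by auto
  have \<theta>0: "0 < \<theta> h" using \<theta>(1) h gain[OF i] v by (cases "\<theta> h = 0") (auto simp: less_le)
  \<comment> \<open>The part of the budget that partition \<open>h\<close> can give up.\<close>
  define c where "c = (1 - v / m) * \<theta> h"
  have q: "0 < v / m" "v / m < 1" using v m by auto
  have c: "0 < c" "c < 1"
  proof -
    show "0 < c" using q \<theta>0 by (simp add: c_def)
    have "c \<le> 1 - v / m" using q \<theta>1 unfolding c_def by (intro mult_left_le) auto
    then show "c < 1" using q by simp
  qed
  define \<theta>' where "\<theta>' g = (\<theta> g - (if g = h then c else 0)) / (1 - c)" for g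
  have \<theta>'h: "\<theta>' h = v / m * \<theta> h / (1 - c)" by (simp add: \<theta>'_def c_def algebra_simps)
  have "(\<Sum>g\<in>parts P. \<theta>' g) = 1"
    using c \<theta>(2) h fin by (simp add: \<theta>'_def sum_divide_distrib[symmetric] sum_subtractf)
  moreover have "0 \<le> \<theta>' g" if "g \<in> parts P" for g
  proof (cases "g = h")
    case True
    then show ?thesis using q \<theta>0 c unfolding True \<theta>'h by (metis diff_gt_0_iff_gt divide_pos_pos less_imp_le mult_pos_pos)
  next
    case False
    then show ?thesis using \<theta>(1) that c by (simp add: \<theta>'_def)
  qed
  ultimately have f': "feasible P \<theta>' (\<alpha>(h := a))" using f a by (auto simp: feasible_iff)
  have "ennreal v < ennreal (v / (1 - c))"
    using v c by (intro ennreal_lessI) (auto simp: field_simps)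
  also have "\<dots> \<le> PFS_rate P \<theta>' (\<alpha>(h := a))"
  proof (rule PFS_rate_ge[OF P f'])
    fix g j assume g: "(g, j) \<in> rivals P"
    show "v / (1 - c) \<le> \<theta>' g * unit_rate P g ((\<alpha>(h := a)) g) j"
    proof (cases "g = h")
      case True
      have "v / m * m \<le> v / m * (\<theta> h * unit_rate P h a j)"
        using mle g q unfolding True by (intro mult_left_mono) auto
      then have "v \<le> v / m * (\<theta> h * unit_rate P h a j)" using m v by simp
      from divide_right_mono[OF this, of "1 - c"] show ?thesis
        using c unfolding True \<theta>'h by (simp add: mult.assoc)
    next
      case False
      from divide_right_mono[OF others[OF g False], of "1 - c"] show ?thesis
        using c False by (simp add: \<theta>'_def)
    qed
  qed
  finally show ?thesis using f' by blast
qed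

text \<open>
  With positive gaps, the equal split of the budget already has a positive rate.
\<close>

lemma optimal_PFS_rate_pos:
  assumes P: "valid_problem P" and opt: "asymptotically_optimal P \<theta> \<alpha>"
    and gaps: "\<forall>d\<in>rivals P. perf P d \<noteq> perf P (bdesign P)"
  shows "0 < PFS_rate P \<theta> \<alpha>"
proof -
  define \<theta>' :: "nat \<Rightarrow> real" where "\<theta>' h = 1 / card (parts P)" for h
  define \<alpha>' :: "nat \<Rightarrow> nat \<Rightarrow> real" where
    "\<alpha>' h r = (if r \<in> support P h then 1 / card (support P h) else 0)" for h r
  have "bdesign P \<in> designs P" using P by (auto simp: valid_problem_def)
  then have n: "0 < card (parts P)"
    by (auto simp: bdesign_def designs_def parts_def)
  have s: "0 < card (support P h)" for h by (auto simp: card_gt_0_iff support_def)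
  have split: "proper_split P h (\<alpha>' h)" for h
    using s[of h] by (auto simp: proper_split_def \<alpha>'_def)
  have f: "feasible P \<theta>' \<alpha>'" using split n by (simp add: feasible_iff \<theta>'_def)
  obtain h i where hi: "(h, i) \<in> rivals P"
    and r: "PFS_rate P \<theta>' \<alpha>' = ennreal (\<theta>' h * unit_rate P h (\<alpha>' h) i)"
    by (rule PFS_rate_attained[OF P f])
  have "h \<in> parts P" using hi by (auto simp: rivals_def designs_def)
  then have "0 < sd P h" using P by (simp add: valid_problem_def)
  moreover have "perf P (bdesign P) - perf P (h, i) \<noteq> 0" using gaps hi by fastforce
  ultimately have "0 < scaled_gap P h i" by (simp add: scaled_gap_def del: perf.simps)
  then have "0 < unit_rate P h (\<alpha>' h) i"
    using s by (intro unit_rate_pos[OF P hi split]) (auto simp: \<alpha>'_def)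
  then have "0 < PFS_rate P \<theta>' \<alpha>'" using n by (simp add: r \<theta>'_def)
  also have "\<dots> \<le> PFS_rate P \<theta> \<alpha>" using opt f by (simp add: asymptotically_optimal_def)
  finally show ?thesis .
qed

section \<open>The rule and the optimum\<close>

lemma rule_extends_to_optimum:
  assumes P: "valid_problem P" and f: "feasible P \<theta> \<alpha>" and pos: "\<forall>h\<in>parts P. 0 < \<theta> h"
    and key: "\<forall>h\<in>parts P. key_design P \<theta> \<alpha> h (key h)"
    and rule: "\<forall>h\<in>parts P. \<forall>r\<in>{1..ndes P h}. \<alpha> h r = alpha_rule P h (key h) r"
  shows "\<exists>\<theta>'. asymptotically_optimal P \<theta>' \<alpha> \<and> (\<forall>h\<in>parts P. 0 < \<theta>' h) \<and>
    (\<forall>h\<in>parts P. key_design P \<theta>' \<alpha> h (key h))"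
proof -
  define c where "c h = unit_rate P h (\<alpha> h) (key h)" for h
  have split: "proper_split P h (\<alpha> h)" if "h \<in> parts P" for h
    using f that by (simp add: feasible_iff)
  have kr: "(h, key h) \<in> rivals P" if "h \<in> parts P" for h
    using key pos that key_design_iff[of P h \<alpha> \<theta> "key h", OF P split[OF that]] by blast
  have cmin: "c h \<le> unit_rate P h (\<alpha> h) j" if "(h, j) \<in> rivals P" for h j
  proof -
    have "h \<in> parts P" using that by (auto simp: rivals_def designs_def)
    then show ?thesis
      using key pos that key_design_iff[of P h \<alpha> \<theta> "key h", OF P split] unfolding c_def by blast
  qed
  have c0: "0 \<le> c h" if "h \<in> parts P" for h
    using unit_rate_nonneg[OF split_support(1)[OF P that split[OF that]]] by (simp add: c_def)
  have upper: "PFS_rate P \<theta>' \<alpha>' \<le> ennreal (\<theta>' h * c h)"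
    if f': "feasible P \<theta>' \<alpha>'" and h: "h \<in> parts P" for \<theta>' \<alpha>' h
  proof -
    have "support P h \<subseteq> {1..ndes P h}" using P h by (auto simp: valid_problem_def support_def)
    then have "unit_rate P h (\<alpha>' h) (key h) \<le> c h"
      unfolding c_def using f' h rule
      by (intro unit_rate_le_rule[OF P kr[OF h]]) (auto simp: feasible_iff)
    then have "\<theta>' h * unit_rate P h (\<alpha>' h) (key h) \<le> \<theta>' h * c h"
      using f' h by (intro mult_left_mono) (auto simp: feasible_iff)
    then show ?thesis
      using PFS_rate_le[OF P f' kr[OF h]] by (meson ennreal_leI order_trans)
  qed
  \<comment> \<open>A key design has \<open>c h = 0\<close> if its mean ties with that of \<open>bdesign P\<close>; then no
    allocation achieves a positive rate.\<close>
  show ?thesis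
  proof (cases "\<exists>h\<in>parts P. c h = 0")
    case True
    then have "PFS_rate P \<theta>' \<alpha>' \<le> PFS_rate P \<theta> \<alpha>" if "feasible P \<theta>' \<alpha>'" for \<theta>' \<alpha>'
      using upper[OF that] by fastforce
    then show ?thesis using f pos key by (auto simp: asymptotically_optimal_def)
  next
    case False
    then have cp: "0 < c h" if "h \<in> parts P" for h using c0 that by (simp add: less_le)
    have fin: "finite (parts P)" by (simp add: parts_def)
    have ne: "parts P \<noteq> {}" using f by (auto simp: feasible_iff)
    define T where "T = (\<Sum>h\<in>parts P. 1 / c h)"
    have T: "0 < T" unfolding T_def using cp fin ne by (intro sum_pos) auto
    define \<theta>' where "\<theta>' h = 1 / c h / T" for h
    have p': "0 < \<theta>' h" if "h \<in> parts P" for h using cp[OF that] T by (simp add: \<theta>'_def)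
    have "(\<Sum>h\<in>parts P. \<theta>' h) = 1"
      using T unfolding \<theta>'_def sum_divide_distrib[symmetric] T_def[symmetric] by simp
    then have f': "feasible P \<theta>' \<alpha>" using f p' by (auto simp: feasible_iff less_imp_le)
    have low: "ennreal (1 / T) \<le> PFS_rate P \<theta>' \<alpha>"
    proof (rule PFS_rate_ge[OF P f'])
      fix h j assume j: "(h, j) \<in> rivals P"
      then have h: "h \<in> parts P" by (auto simp: rivals_def designs_def)
      have "1 / T = \<theta>' h * c h" using cp[OF h] by (simp add: \<theta>'_def)
      also have "\<dots> \<le> \<theta>' h * unit_rate P h (\<alpha> h) j"
        using cmin[OF j] p'[OF h] by (intro mult_left_mono) auto
      finally show "1 / T \<le> \<theta>' h * unit_rate P h (\<alpha> h) j" .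
    qed
    have "PFS_rate P \<theta>2 \<alpha>2 \<le> ennreal (1 / T)" if f2: "feasible P \<theta>2 \<alpha>2" for \<theta>2 \<alpha>2
    proof -
      \<comment> \<open>Both families of shares sum to 1, so \<open>\<theta>2\<close> cannot be larger everywhere.\<close>
      have "\<exists>h\<in>parts P. \<theta>2 h \<le> \<theta>' h"
      proof (rule ccontr)
        assume "\<not> ?thesis"
        then have "(\<Sum>h\<in>parts P. \<theta>' h) < (\<Sum>h\<in>parts P. \<theta>2 h)"
          using fin ne by (intro sum_strict_mono) (auto simp: not_le)
        then show False using f' f2 by (simp add: feasible_iff)
      qed
      then obtain h where h: "h \<in> parts P" and le: "\<theta>2 h \<le> \<theta>' h" by blast
      have "\<theta>2 h * c h \<le> \<theta>' h * c h" using le c0[OF h] by (intro mult_right_mono)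
      also have "\<dots> = 1 / T" using cp[OF h] by (simp add: \<theta>'_def)
      finally show ?thesis using upper[OF f2 h] by (meson ennreal_leI order_trans)
    qed
    then have "asymptotically_optimal P \<theta>' \<alpha>"
      using f' low by (meson asymptotically_optimal_def order_trans)
    moreover have "key_design P \<theta>' \<alpha> h (key h)" if h: "h \<in> parts P" for h
      using key_design_iff[of P h \<alpha> \<theta>' "key h", OF P split[OF h] p'[OF h]] kr[OF h] cmin unfolding c_def by blast
    ultimately show ?thesis using p' by blast
  qed
qed

lemma optimum_follows_rule:
  assumes P: "valid_problem P" and opt: "asymptotically_optimal P \<theta> \<alpha>"
    and gaps: "\<forall>d\<in>rivals P. perf P d \<noteq> perf P (bdesign P)"
    and h: "h \<in> parts P" and key: "key_design P \<theta> \<alpha> h i"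
    and unique: "\<forall>j. key_design P \<theta> \<alpha> h j \<longrightarrow> j = i"
    and r: "r \<in> {1..ndes P h}"
  shows "\<alpha> h r = alpha_rule P h i r"
proof (rule ccontr)
  assume neq: "\<alpha> h r \<noteq> alpha_rule P h i r"
  let ?u = "unit_rate P h (\<alpha> h)"
  have f: "feasible P \<theta> \<alpha>" using opt by (simp add: asymptotically_optimal_def)
  have split: "proper_split P h (\<alpha> h)" using f h by (simp add: feasible_iff)
  have rs: "r \<in> support P h" 
  proof (rule ccontr)
    assume "r \<notin> support P h"
    then have "\<alpha> h r = 0" "alpha_rule P h i r = 0"
      using split r by (simp_all add: proper_split_def alpha_rule_def)
    then show False using neq by simp
  qed
  obtain v where PFS: "PFS_rate P \<theta> \<alpha> = ennreal v"
    by (rule PFS_rate_attained[OF P f])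
  then have v: "0 < v" using optimal_PFS_rate_pos[OF P opt gaps] by simp
  have vle: "v \<le> \<theta> g * unit_rate P g (\<alpha> g) j" if "(g, j) \<in> rivals P" for g j
  proof -
    have "ennreal v \<le> ennreal (\<theta> g * unit_rate P g (\<alpha> g) j)" using PFS_rate_le[OF P f that] PFS by simp
    then show ?thesis using v by (simp add: ennreal_le_iff2)
  qed
  have i: "(h, i) \<in> rivals P"
    using key P by (auto simp: key_design_def is_arg_min_def valid_problem_def nonsel_def rivals_def)
  have \<theta>: "0 < \<theta> h" using vle[OF i] v f h by (cases "\<theta> h = 0") (auto simp: feasible_iff less_le)
  note iff = key_design_iff[of P h \<alpha> \<theta>, OF P split \<theta>]
  have ui: "0 < ?u i"
    using vle[OF i] v \<theta> by (meson less_le_trans zero_less_mult_pos)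
  \<comment> \<open>Uniqueness of the key design leaves room for the other designs to lose a little.\<close>
  have gap: "?u i < ?u j" if j: "(h, j) \<in> rivals P" "j \<noteq> i" for j
  proof -
    have "\<not> key_design P \<theta> \<alpha> h j" using unique j by blast
    then obtain k where "(h, k) \<in> rivals P" "?u k < ?u j" using iff[of j] j(1) by (auto simp: not_le)
    then show ?thesis using key iff[of i] by fastforce
  qed
  define J where "J = {j. (h, j) \<in> rivals P \<and> j \<noteq> i}"
  have "J \<subseteq> snd ` rivals P" by (force simp: J_def)
  then have J: "finite J" using finite_rivals by (auto intro: finite_subset)
  have "\<forall>\<^sub>F t in at_right 0. ?u i < (1 - t) * ?u j" if "j \<in> J" for j
  proof -
    have "((\<lambda>t. (1 - t) * ?u j) \<longlongrightarrow> (1 - 0) * ?u j) (at_right 0)" by (intro tendsto_intros)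
    then show ?thesis using gap that by (intro order_tendstoD(1)) (auto simp: J_def)
  qed
  then have "\<forall>\<^sub>F t in at_right 0. \<forall>j\<in>J. ?u i < (1 - t) * ?u j"
    using J by (simp add: eventually_ball_finite)
  moreover have "\<forall>\<^sub>F t in at_right (0::real). 0 < t \<and> t < 1"
    using eventually_at_right_less[of "0::real"] order_tendstoD(2)[OF tendsto_ident_at, of "0::real" 1]
    by (simp add: eventually_conj)
  ultimately have "\<forall>\<^sub>F t in at_right 0. (\<forall>j\<in>J. ?u i < (1 - t) * ?u j) \<and> 0 < t \<and> t < 1"
    by (rule eventually_conj)
  then obtain t where tJ: "\<forall>j\<in>J. ?u i < (1 - t) * ?u j" and t: "0 < t" "t < 1"
    using eventually_happens[of _ "at_right (0::real)"] by auto
  define a where "a r = (1 - t) * \<alpha> h r + t * alpha_rule P h i r" for r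
  note b = proper_split_rule[OF abs_weight_pos[OF P i]]
  have a: "proper_split P h a" unfolding a_def using proper_split_mix[OF split b] t by simp
  have better: "?u i < unit_rate P h a j" if j: "(h, j) \<in> rivals P" for j
  proof (cases "j = i")
    case True
    then show ?thesis
      using unit_rate_mix_rule_gt[OF P i split t rs neq ui] unfolding a_def by simp
  next
    case False
    then have "?u i < (1 - t) * ?u j" using tJ j by (simp add: J_def)
    also have "\<dots> \<le> unit_rate P h a j"
      unfolding a_def using t by (intro unit_rate_mix_ge[OF P j split b]) auto
    finally show ?thesis .
  qed
  have "v < \<theta> h * unit_rate P h a j" if "(h, j) \<in> rivals P" for j
    using vle[OF i] mult_strict_left_mono[OF better[OF that] \<theta>] by simp
  then obtain \<theta>' where "feasible P \<theta>' (\<alpha>(h := a))" "ennreal v < PFS_rate P \<theta>' (\<alpha>(h := a))"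
    using gain_in_one_partition_improves[OF P f h a v vle _ i] by blast
  then show False using opt PFS by (auto simp: asymptotically_optimal_def not_le[symmetric])
qed

theorem theorem3:
  fixes P :: selection_problem
  assumes "valid_problem P"
  shows
    "(\<forall>\<theta> \<alpha> key.
        feasible P \<theta> \<alpha> \<and> (\<forall>h\<in>parts P. 0 < \<theta> h) \<and>
        (\<forall>h\<in>parts P. key_design P \<theta> \<alpha> h (key h)) \<and>
        (\<forall>h\<in>parts P. \<forall>r\<in>{1..ndes P h}. \<alpha> h r = alpha_rule P h (key h) r) \<longrightarrow>
        (\<exists>\<theta>'. asymptotically_optimal P \<theta>' \<alpha> \<and> (\<forall>h\<in>parts P. 0 < \<theta>' h) \<and>
           (\<forall>h\<in>parts P. key_design P \<theta>' \<alpha> h (key h))))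
     \<and>
     (\<forall>\<theta> \<alpha> h key.
        asymptotically_optimal P \<theta> \<alpha> \<and>
        (\<forall>d\<in>designs P - {bdesign P}. perf P d \<noteq> perf P (bdesign P)) \<and>
        h \<in> parts P \<and> key_design P \<theta> \<alpha> h key \<and> (\<forall>j. key_design P \<theta> \<alpha> h j \<longrightarrow> j = key) \<longrightarrow>
        (\<forall>r\<in>{1..ndes P h}. \<alpha> h r = alpha_rule P h key r))"
proof (intro conjI allI impI ballI)
  fix \<theta> \<alpha> key
  assume "feasible P \<theta> \<alpha> \<and> (\<forall>h\<in>parts P. 0 < \<theta> h) \<and>
    (\<forall>h\<in>parts P. key_design P \<theta> \<alpha> h (key h)) \<and>
    (\<forall>h\<in>parts P. \<forall>r\<in>{1..ndes P h}. \<alpha> h r = alpha_rule P h (key h) r)"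
  then show "\<exists>\<theta>'. asymptotically_optimal P \<theta>' \<alpha> \<and> (\<forall>h\<in>parts P. 0 < \<theta>' h) \<and>
      (\<forall>h\<in>parts P. key_design P \<theta>' \<alpha> h (key h))"
    using rule_extends_to_optimum[OF assms] by blast
next
  fix \<theta> \<alpha> h key r
  assume "asymptotically_optimal P \<theta> \<alpha> \<and>
    (\<forall>d\<in>designs P - {bdesign P}. perf P d \<noteq> perf P (bdesign P)) \<and>
    h \<in> parts P \<and> key_design P \<theta> \<alpha> h key \<and> (\<forall>j. key_design P \<theta> \<alpha> h j \<longrightarrow> j = key)"
    and "r \<in> {1..ndes P h}"
  then show "\<alpha> h r = alpha_rule P h key r"
    using optimum_follows_rule[OF assms, unfolded rivals_def] by blast
qed

end
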